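(* Let $m \ge 2$ be an integer and let $\lambda$ be a real number with $0 \le \lambda \le 1$ and $\lambda^{m} + \lambda^{m-1} \le 1$. Then every non-empty finite $m$-free oriented simple graph $D$ has a vertex $v$ with $d_2^+(v) \ge \lambda\, d_1^+(v)$. Equivalently, $\lambda_m$ is at least the unique positive real root of $x^m + x^{m-1} = 1$.
   Context: All digraphs are finite oriented simple graphs: no loops, no multiple edges, and no directed 2-cycles. For vertices $u,v$ of a digraph $D$, $d(u,v)$ is the length of a shortest directed path from $u$ to $v$, with the convention that $d(v,v)$ is the length of a shortest directed cycle through $v$ (not $0$). $N_k^+(v)$ is the set of vertices $u$ with $d(v,u)=k$, and $d_k^+(v)=|N_k^+(v)|$. A digraph is $m$-free if it contains no directed cycle of length at most $m$. $\lambda_m$ denotes the largest real number such that every $m$-free digraph has a vertex $v$ with $d_2^+(v) \ge \lambda_m d_1^+(v)$. *)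

theory Defs
  imports Complex_Main
begin

definition oriented_graph :: "'a set \<Rightarrow> ('a \<times> 'a) set \<Rightarrow> bool" where
  "oriented_graph V E \<longleftrightarrow> finite V \<and> E \<subseteq> V \<times> V \<and> (\<forall>x. (x, x) \<notin> E)
     \<and> (\<forall>x y. (x, y) \<in> E \<longrightarrow> (y, x) \<notin> E)"

definition walk :: "('a \<times> 'a) set \<Rightarrow> nat \<Rightarrow> 'a \<Rightarrow> 'a \<Rightarrow> bool" where
  "walk E k u v \<longleftrightarrow> (\<exists>p :: nat \<Rightarrow> 'a. p 0 = u \<and> p k = v \<and> (\<forall>i<k. (p i, p (Suc i)) \<in> E))"

definition has_cycle :: "('a \<times> 'a) set \<Rightarrow> nat \<Rightarrow> bool" where
  "has_cycle E k \<longleftrightarrow> (\<exists>xs. length xs = k \<and> k \<ge> 1 \<and> distinct xs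
     \<and> (\<forall>i<k. (xs ! i, xs ! ((i + 1) mod k)) \<in> E))"

definition m_free :: "('a \<times> 'a) set \<Rightarrow> nat \<Rightarrow> bool" where
  "m_free E m \<longleftrightarrow> (\<forall>k. 1 \<le> k \<and> k \<le> m \<longrightarrow> \<not> has_cycle E k)"

text \<open>N_k^+(v) for k >= 1: vertices u with d(v,u) = k, where d(v,u) is the least positive
  length of a directed walk from v to u (for u = v this is the length of a shortest directed
  cycle through v; for u \<noteq> v it is the length of a shortest directed path).\<close>
definition out_nbhd :: "('a \<times> 'a) set \<Rightarrow> 'a \<Rightarrow> nat \<Rightarrow> 'a set" where
  "out_nbhd E v k = {u. walk E k v u \<and> (\<forall>j. 0 < j \<and> j < k \<longrightarrow> \<not> walk E j v u)}"

definition out_deg :: "('a \<times> 'a) set \<Rightarrow> 'a \<Rightarrow> nat \<Rightarrow> nat" where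
  "out_deg E v k = card (out_nbhd E v k)"

end

theory Submission
  imports Defs
begin

text \<open>In a counterexample \<open>(V, E)\<close> that is minimal among sub-digraphs, deleting the edges from a
  vertex set \<open>X\<close> to a part of its out-boundary must create a good vertex. Iterating this over
  growing parts of the boundary shows that the second boundary of \<open>X\<close> is at most \<open>\<lambda>\<close> times the
  first. Applied to out-balls, this makes the layers \<open>N\<^sub>i(v)\<close>, \<open>1 \<le> i \<le> m\<close>, decay geometrically with
  ratio \<open>\<lambda>\<close>. Iterated from any nonempty \<open>X\<close>, it bounds \<open>(1 - \<lambda>) |V - X|\<close> by the boundary of \<open>X\<close>;
  for \<open>X\<close> the complement of the in-ball of radius \<open>m\<close> around \<open>y\<close>, it bounds \<open>1 - \<lambda>\<close> times the sum
  of the first \<open>m\<close> in-layers of \<open>y\<close> by the \<open>m\<close>-th one. Summing over all vertices, with \<open>S\<^sub>i\<close> the number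
  of pairs at distance \<open>i\<close>, gives \<open>(1 - \<lambda>) (S\<^sub>1 + \<dots> + S\<^sub>m) \<le> S\<^sub>m\<close> and \<open>S\<^sub>m \<le> \<lambda>\<^bsup>m-i\<^esup> S\<^sub>i\<close>, the latter strict
  for \<open>i = 1\<close>; together these force \<open>\<lambda>\<^bsup>m\<^esup> + \<lambda>\<^bsup>m-1\<^esup> > 1\<close>.\<close>

section \<open>Walks, relation powers and cycles\<close>

lemma walk_iff_relpow: "walk E k u v \<longleftrightarrow> (u, v) \<in> E ^^ k"
  unfolding walk_def relpow_fun_conv by blast

lemma relpow_mono: "R \<subseteq> S \<Longrightarrow> R ^^ n \<subseteq> S ^^ n" for R S :: "('a \<times> 'a) set"
  by (induction n) (simp_all add: relcomp_mono)

lemma out_nbhd_1: "out_nbhd E v 1 = E `` {v}"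
  by (auto simp: out_nbhd_def walk_iff_relpow)

lemma out_nbhd_2: "out_nbhd E v 2 = E `` (E `` {v}) - E `` {v}"
proof -
  have "(\<forall>j. 0 < j \<and> j < 2 \<longrightarrow> P j) \<longleftrightarrow> P 1" for P :: "nat \<Rightarrow> bool"
    by (auto simp: less_2_cases_iff)
  moreover have "(v, u) \<in> E ^^ 2 \<longleftrightarrow> u \<in> E `` (E `` {v})" for u
    by (auto simp: numeral_2_eq_2)
  ultimately show ?thesis
    by (auto simp: out_nbhd_def walk_iff_relpow)
qed

text \<open>A shortest closed walk, taken over all base points, repeats no vertex: the segment
  between two visits to one vertex would be a shorter closed walk.\<close>

lemma closed_walk_imp_cycle:
  assumes "(v, v) \<in> E ^^ k" "1 \<le> k"
  shows "\<exists>j. 1 \<le> j \<and> j \<le> k \<and> has_cycle E j"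
proof -
  define Q where "Q j \<longleftrightarrow> 1 \<le> j \<and> (\<exists>w. (w, w) \<in> E ^^ j)" for j
  define j where "j = (LEAST j. Q j)"
  have "Q k" using assms by (auto simp: Q_def)
  then have "Q j" "j \<le> k" and least: "\<And>i. i < j \<Longrightarrow> \<not> Q i"
    unfolding j_def by (auto intro: LeastI Least_le dest: not_less_Least)
  then obtain w p where p: "p 0 = w" "p j = w" "\<And>i. i < j \<Longrightarrow> (p i, p (Suc i)) \<in> E" and j: "1 \<le> j"
    by (auto simp: Q_def relpow_fun_conv)
  have "p a \<noteq> p b" if "a < b" "b < j" for a b
  proof
    assume eq: "p a = p b"
    have "(p a, p b) \<in> E ^^ (b - a)"
      unfolding relpow_fun_conv
      by (rule exI[of _ "\<lambda>i. p (a + i)"]) (use that p in auto)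
    then have "Q (b - a)" using eq that by (auto simp: Q_def)
    with least[of "b - a"] that show False by linarith
  qed
  then have "inj_on p {0..<j}"
    by (intro linorder_inj_onI) auto
  then have "distinct (map p [0..<j])"
    by (simp add: distinct_map)
  moreover have "(map p [0..<j] ! i, map p [0..<j] ! ((i + 1) mod j)) \<in> E" if "i < j" for i
  proof (cases "i + 1 < j")
    case True
    then show ?thesis using p(3)[OF that] that by simp
  next
    case False
    then have "i + 1 = j" using that by simp
    then show ?thesis using p(1,2) p(3)[OF that] that by simp
  qed
  ultimately have "has_cycle E j"
    unfolding has_cycle_def using j by (intro exI[of _ "map p [0..<j]"]) simp
  then show ?thesis using j \<open>j \<le> k\<close> by blast
qed

section \<open>Boundaries of vertex sets in a minimal counterexample\<close>

locale minimal_counterexample =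
  fixes V :: "'a set" and E :: "('a \<times> 'a) set" and lam :: real
  assumes finite_V: "finite V" and edges: "E \<subseteq> V \<times> V" and lam_nonneg: "0 \<le> lam"
    and few_second: "\<And>v. v \<in> V \<Longrightarrow> real (card (E `` (E `` {v}) - E `` {v})) < lam * real (card (E `` {v}))"
    and minimal: "\<And>V' E'. \<lbrakk>V' \<subseteq> V; E' \<subseteq> E; E' \<subseteq> V' \<times> V'; V' \<noteq> {}; V' \<noteq> V \<or> E' \<noteq> E\<rbrakk> \<Longrightarrow>
      \<exists>v\<in>V'. lam * real (card (E' `` {v})) \<le> real (card (E' `` (E' `` {v}) - E' `` {v}))"
begin

definition boundary :: "'a set \<Rightarrow> 'a set" where
  "boundary X = E `` X - X"

lemma finite_image [simp]: "finite (E `` X)"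
  by (rule finite_subset[OF _ finite_V]) (use edges in auto)

lemma finite_boundary [simp]: "finite (boundary X)"
  by (simp add: boundary_def)

text \<open>Deleting the edges from \<open>X\<close> to \<open>boundary X - P\<close> can only create a good vertex \<open>u\<close>
  in \<open>X\<close>; the set \<open>L\<close> consists of the out-neighbours lost by \<open>u\<close>.\<close>
lemma boundary_step:
  assumes "P \<subset> boundary X"
  shows "\<exists>L. L \<noteq> {} \<and> L \<subseteq> boundary X - P \<and>
    real (card ((L \<union> E `` L) - (X \<union> P \<union> E `` P))) < (1 + lam) * real (card L)"
proof -
  define H where "H = E - X \<times> (boundary X - P)"
  have "H \<subseteq> E" "H \<noteq> E" using assms by (auto simp: H_def boundary_def)
  moreover from this have "V \<noteq> {}" using edges by auto
  ultimately obtain u where u: "u \<in> V"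
    and good: "lam * real (card (H `` {u})) \<le> real (card (H `` (H `` {u}) - H `` {u}))"
    using minimal[of V H] edges by blast
  have fin: "finite (H `` A)" for A
    by (rule finite_subset[OF _ finite_image[of A]]) (use \<open>H \<subseteq> E\<close> in auto)
  define L where "L = E `` {u} - H `` {u}"
  have sub: "H `` {u} \<subseteq> E `` {u}" "H `` (H `` {u}) \<subseteq> E `` (E `` {u})" using \<open>H \<subseteq> E\<close> by blast+
  \<comment> \<open>If \<open>u\<close> lost no out-neighbour, its second neighbourhood in
    \<open>E\<close> would be at least as large as in \<open>H\<close>, so \<open>u\<close> would be
    good in \<open>E\<close> too.\<close>
  have ne: "L \<noteq> {}"
  proof
    assume "L = {}"
    then have eq: "H `` {u} = E `` {u}" using sub by (auto simp: L_def)
    have "card (H `` (H `` {u}) - H `` {u}) \<le> card (E `` (E `` {u}) - E `` {u})"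
      using sub eq by (intro card_mono) auto
    then show False using good few_second[OF u] eq by simp
  qed
  then have "u \<in> X" and LB: "L \<subseteq> boundary X - P" by (auto simp: L_def H_def)
  let ?S = "E `` {u} \<union> E `` (E `` {u})" and ?SH = "H `` {u} \<union> H `` (H `` {u})"
  have cS: "card ?S = card (E `` {u}) + card (E `` (E `` {u}) - E `` {u})"
    by (subst card_Un_disjoint[symmetric]) (auto intro: arg_cong[of _ _ card])
  have cSH: "card ?SH = card (H `` {u}) + card (H `` (H `` {u}) - H `` {u})"
    by (subst card_Un_disjoint[symmetric]) (auto simp: fin intro: arg_cong[of _ _ card])
  have cL: "real (card L) = real (card (E `` {u})) - real (card (H `` {u}))"
    unfolding L_def using sub by (simp add: card_Diff_subset fin card_mono of_nat_diff)
  have "?SH \<subseteq> ?S" using sub by blast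
  \<comment> \<open>Badness of \<open>u\<close> in \<open>E\<close> gives |\<open>?S\<close>| < (1 +
    \<open>lam\<close>) |\<open>E\<close>
    {u}\<open>|, goodness in\<close>H\<open>gives |\<close>?SH\<open>| \<ge> (1 +\<close>lam\<open>) |\<close>H
    \<open>{u}\<close>|; subtract.\<close>
  then have "real (card (?S - ?SH)) = real (card ?S) - real (card ?SH)"
    by (simp add: card_Diff_subset fin card_mono of_nat_diff)
  also have "\<dots> < (1 + lam) * real (card L)"
    using good few_second[OF u] by (simp add: cS cSH cL algebra_simps)
  finally have lost: "real (card (?S - ?SH)) < (1 + lam) * real (card L)" .
  \<comment> \<open>In \<open>H\<close>, edges from \<open>X\<close> end in
    \<open>X \<union> P\<close>. So whatever \<open>L \<union> E\<close>
    L\<open>adds outside\<close>X \<union> P \<union> E \<open>P\<close> was reached by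
    \<open>u\<close> in at most two steps before the deletion and no longer is.\<close>
  have "H `` {u} \<subseteq> X \<union> P" using \<open>u \<in> X\<close> by (auto simp: H_def boundary_def)
  moreover have "H `` X \<subseteq> X \<union> P" by (auto simp: H_def boundary_def)
  moreover have "H `` P \<subseteq> E `` P" using \<open>H \<subseteq> E\<close> by blast
  ultimately have "?SH \<subseteq> X \<union> P \<union> E `` P" by blast
  moreover have "L \<union> E `` L \<subseteq> ?S" by (auto simp: L_def)
  ultimately have "(L \<union> E `` L) - (X \<union> P \<union> E `` P) \<subseteq> ?S - ?SH" by blast
  then have "card ((L \<union> E `` L) - (X \<union> P \<union> E `` P)) \<le> card (?S - ?SH)"
    by (intro card_mono) auto
  with lost ne LB show ?thesis by (intro exI[of _ L]) linarith
qed

text \<open>\<open>F\<close> collects the parts of the boundary that satisfy the cumulative bound.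
  By \<open>boundary_step\<close> a proper part in \<open>F\<close> can be enlarged within
  \<open>F\<close>, so a maximal one is the whole boundary, where the bound reads |B| + |second
  boundary| \<le> (1 + \<open>lam\<close>) |B|.\<close>

lemma card_second_boundary: "real (card (boundary (X \<union> boundary X))) \<le> lam * real (card (boundary X))"
proof -
  let ?B = "boundary X"
  define F where "F = {P. P \<subseteq> ?B \<and> real (card ((P \<union> E `` P) - X)) \<le> (1 + lam) * real (card P)}"
  have "finite F" by (rule finite_subset[of _ "Pow ?B"]) (auto simp: F_def)
  moreover have "{} \<in> F" by (simp add: F_def)
  ultimately obtain P where "P \<in> F" and max: "\<And>Q. Q \<in> F \<Longrightarrow> P \<subseteq> Q \<Longrightarrow> P = Q"
    using finite_has_maximal[of F] by blast
  then have PB: "P \<subseteq> ?B" and cP: "real (card ((P \<union> E `` P) - X)) \<le> (1 + lam) * real (card P)"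
    by (auto simp: F_def)
  have finP: "finite P" using PB finite_subset finite_boundary by blast
  have "P = ?B"
  proof (rule ccontr)
    assume "P \<noteq> ?B"
    then obtain L where L: "L \<noteq> {}" "L \<subseteq> ?B - P"
      and cL: "real (card ((L \<union> E `` L) - (X \<union> P \<union> E `` P))) < (1 + lam) * real (card L)"
      using boundary_step[of P X] PB by blast
    have finL: "finite L" using L(2) finite_subset finite_boundary by blast
    have "(P \<union> L \<union> E `` (P \<union> L)) - X =
        ((P \<union> E `` P) - X) \<union> ((L \<union> E `` L) - (X \<union> P \<union> E `` P))" by blast
    then have "card ((P \<union> L \<union> E `` (P \<union> L)) - X)
        \<le> card ((P \<union> E `` P) - X) + card ((L \<union> E `` L) - (X \<union> P \<union> E `` P))"
      using card_Un_le by metis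
    moreover have "card (P \<union> L) = card P + card L"
      using L(2) finP finL by (intro card_Un_disjoint) auto
    ultimately have "P \<union> L \<in> F"
      using cP cL PB L(2) by (auto simp: F_def algebra_simps)
    then show False using max[of "P \<union> L"] L by blast
  qed
  moreover have "(?B \<union> E `` ?B) - X = ?B \<union> boundary (X \<union> ?B)"
    by (auto simp: boundary_def)
  moreover have "card (?B \<union> boundary (X \<union> ?B)) = card ?B + card (boundary (X \<union> ?B))"
    by (intro card_Un_disjoint) (auto simp: boundary_def)
  ultimately show ?thesis using cP by (simp add: algebra_simps)
qed

text \<open>If no edge left \<open>X\<close>, the sub-digraph induced on \<open>X\<close> would keep
  all first and second out-neighbourhoods of its vertices, hence be a smaller
  counterexample.\<close>

lemma boundary_nonempty:
  assumes "X \<noteq> {}" "X \<subset> V"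
  shows "boundary X \<noteq> {}"
proof
  assume "boundary X = {}"
  then have closed: "E `` X \<subseteq> X" by (auto simp: boundary_def)
  define H where "H = E \<inter> X \<times> X"
  have eq: "H `` A = E `` A" if "A \<subseteq> X" for A using that closed by (auto simp: H_def)
  obtain v where v: "v \<in> X"
    and good: "lam * real (card (H `` {v})) \<le> real (card (H `` (H `` {v}) - H `` {v}))"
    using minimal[of X H] assms by (auto simp: H_def)
  have "H `` {v} = E `` {v}" "H `` (E `` {v}) = E `` (E `` {v})"
    using v closed by (auto intro!: eq)
  then show False using good few_second[of v] v assms by auto
qed

text \<open>Absorb the boundary B into \<open>X\<close> and induct: the remaining complement R
  satisfies (1 - \<open>lam\<close>) |R| \<le> |second boundary| \<le> \<open>lam\<close> |B|, and
  adding (1 - \<open>lam\<close>) |B| gives the claim.\<close>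

lemma card_boundary_ge:
  assumes "X \<noteq> {}" "X \<subseteq> V"
  shows "(1 - lam) * real (card (V - X)) \<le> real (card (boundary X))"
  using assms
proof (induction "card (V - X)" arbitrary: X rule: less_induct)
  case less
  show ?case
  proof (cases "X = V")
    case False
    let ?B = "boundary X"
    have BV: "?B \<subseteq> V - X" using edges by (auto simp: boundary_def)
    have "?B \<noteq> {}" using boundary_nonempty less.prems False by blast
    then have "card (V - (X \<union> ?B)) < card (V - X)"
      using BV finite_V by (intro psubset_card_mono) auto
    then have "(1 - lam) * real (card (V - (X \<union> ?B))) \<le> real (card (boundary (X \<union> ?B)))"
      using less.hyps[of "X \<union> ?B"] less.prems BV by auto
    also have "\<dots> \<le> lam * real (card ?B)" by (rule card_second_boundary)
    finally have *: "(1 - lam) * real (card (V - (X \<union> ?B))) \<le> lam * real (card ?B)" .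
    have "card (V - X) = card ?B + card (V - (X \<union> ?B))"
      using BV finite_V by (subst card_Un_disjoint[symmetric]) (auto intro: arg_cong[of _ _ card])
    then show ?thesis using * by (simp add: algebra_simps)
  qed simp
qed

section \<open>Distance layers around a vertex\<close>

text \<open>For \<open>j \<le> m\<close> the vertex \<open>v\<close> is not in its own \<open>j\<close>-th neighbourhood, so allowing
  the walk of length \<open>0\<close> here makes no difference.\<close>
lemma boundary_ball:
  assumes free: "\<And>k w. \<lbrakk>1 \<le> k; k \<le> m\<rbrakk> \<Longrightarrow> (w, w) \<notin> E ^^ k" and j: "1 \<le> j" "j \<le> m"
  shows "boundary {u. \<exists>i<j. (v, u) \<in> E ^^ i} = out_nbhd E v j"
proof (intro set_eqI iffI)
  fix u assume "u \<in> boundary {u. \<exists>i<j. (v, u) \<in> E ^^ i}"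
  then obtain i where i: "i < j" "(v, u) \<in> E ^^ Suc i" and no: "\<And>i. i < j \<Longrightarrow> (v, u) \<notin> E ^^ i"
    by (auto simp: boundary_def intro: relpow_Suc_I)
  from no[of "Suc i"] i have "Suc i = j" by (metis Suc_lessI)
  then show "u \<in> out_nbhd E v j" using i no by (auto simp: out_nbhd_def walk_iff_relpow)
next
  fix u assume "u \<in> out_nbhd E v j"
  then have u: "(v, u) \<in> E ^^ j" and no: "\<And>i. 0 < i \<Longrightarrow> i < j \<Longrightarrow> (v, u) \<notin> E ^^ i"
    by (auto simp: out_nbhd_def walk_iff_relpow)
  obtain i where i: "j = Suc i" using j by (cases j) auto
  then obtain w where w: "(v, w) \<in> E ^^ i" "(w, u) \<in> E" using u by auto
  have "v \<noteq> u" using u free j by blast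
  then have "(v, u) \<notin> E ^^ i'" if "i' < j" for i'
    using no[of i'] that by (cases i') auto
  then show "u \<in> boundary {u. \<exists>i<j. (v, u) \<in> E ^^ i}" using w i by (auto simp: boundary_def)
qed

lemma card_layer_Suc:
  assumes free: "\<And>k w. \<lbrakk>1 \<le> k; k \<le> m\<rbrakk> \<Longrightarrow> (w, w) \<notin> E ^^ k" and j: "1 \<le> j" "j < m"
  shows "real (card (out_nbhd E v (Suc j))) \<le> lam * real (card (out_nbhd E v j))"
proof -
  let ?X = "\<lambda>j. {u. \<exists>i<j. (v, u) \<in> E ^^ i}"
  have "boundary (?X j) = out_nbhd E v j" "boundary (?X (Suc j)) = out_nbhd E v (Suc j)"
    using boundary_ball[of m, OF free] j by auto
  moreover have "?X (Suc j) = ?X j \<union> boundary (?X j)"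
  proof -
    obtain i where i: "j = Suc i" using j by (cases j) auto
    have "u \<in> boundary (?X j)" if "(v, u) \<in> E ^^ j" "u \<notin> ?X j" for u
      using that by (auto simp: boundary_def i)
    moreover have "boundary (?X j) \<subseteq> ?X (Suc j)"
      by (auto simp: boundary_def intro: relpow_Suc_I)
    ultimately show ?thesis by (auto simp: less_Suc_eq)
  qed
  ultimately show ?thesis using card_second_boundary[of "?X j"] by simp
qed

lemma in_ball_bound:
  assumes free: "\<And>k w. \<lbrakk>1 \<le> k; k \<le> m\<rbrakk> \<Longrightarrow> (w, w) \<notin> E ^^ k" and y: "y \<in> V"
  shows "(1 - lam) * (\<Sum>i=1..m. real (card {x \<in> V. y \<in> out_nbhd E x i}))
    \<le> real (card {x \<in> V. y \<in> out_nbhd E x m})"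
proof -
  let ?P = "\<lambda>i. {x \<in> V. y \<in> out_nbhd E x i}"
  define X where "X = {x \<in> V. \<forall>i\<in>{1..m}. (x, y) \<notin> E ^^ i}"
  \<comment> \<open>Only walks of positive length count in \<open>X\<close>, so freeness puts
    \<open>y\<close> itself in \<open>X\<close>; this supplies the nonempty set for
    \<open>card_boundary_ge\<close>.\<close>
  have "y \<in> X" using free y by (auto simp: X_def)
  have "V - X = (\<Union>i\<in>{1..m}. ?P i)"
  proof (intro set_eqI iffI)
    fix x assume x: "x \<in> V - X"
    define i where "i = (LEAST i. 1 \<le> i \<and> (x, y) \<in> E ^^ i)"
    obtain i0 where i0: "1 \<le> i0" "i0 \<le> m" "(x, y) \<in> E ^^ i0" using x by (auto simp: X_def)
    then have "1 \<le> i \<and> (x, y) \<in> E ^^ i" "i \<le> i0"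
      unfolding i_def by (auto intro: LeastI2 Least_le)
    moreover have "(x, y) \<notin> E ^^ i'" if "0 < i'" "i' < i" for i'
      using not_less_Least[of i' "\<lambda>i. 1 \<le> i \<and> (x, y) \<in> E ^^ i"] that by (auto simp: i_def)
    ultimately have "x \<in> ?P i" using x by (auto simp: out_nbhd_def walk_iff_relpow)
    then show "x \<in> (\<Union>i\<in>{1..m}. ?P i)" using \<open>1 \<le> i \<and> _\<close> \<open>i \<le> i0\<close> i0 by auto
  qed (auto simp: X_def out_nbhd_def walk_iff_relpow)
  moreover have "?P i \<inter> ?P j = {}" if "i \<in> {1..m}" "j \<in> {1..m}" "i \<noteq> j" for i j
    using that by (auto simp: out_nbhd_def walk_iff_relpow) (metis Suc_le_eq nat_neq_iff)
  ultimately have "card (V - X) = (\<Sum>i=1..m. card (?P i))"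
    using finite_V by (simp add: card_UN_disjoint)
  moreover have "boundary X \<subseteq> ?P m"
  proof
    fix x assume "x \<in> boundary X"
    then obtain w where w: "w \<in> X" "(w, x) \<in> E" "x \<notin> X" "x \<in> V" using edges by (auto simp: boundary_def)
    then obtain i where i: "1 \<le> i" "i \<le> m" "(x, y) \<in> E ^^ i" by (auto simp: X_def)
    \<comment> \<open>A walk from \<open>x\<close> to \<open>y\<close> shorter than
      \<open>m\<close>, prefixed by the edge from \<open>w\<close>, would have length at most
      \<open>m\<close>, contrary to \<open>w \<in> X\<close>.\<close>
    have far: "(x, y) \<notin> E ^^ i'" if "i' < m" for i'
    proof
      assume "(x, y) \<in> E ^^ i'"
      then have "(w, y) \<in> E ^^ Suc i'" using w relpow_Suc_I2 by metis
      moreover have "Suc i' \<in> {1..m}" using that by simp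
      ultimately show False using w(1) by (auto simp: X_def simp del: relpow.simps)
    qed
    then have "i = m" using i by (metis le_neq_implies_less)
    then show "x \<in> ?P m" using i far w by (auto simp: out_nbhd_def walk_iff_relpow)
  qed
  then have "card (boundary X) \<le> card (?P m)" using finite_V by (intro card_mono) auto
  ultimately show ?thesis
    using card_boundary_ge[of X] \<open>y \<in> X\<close> X_def by fastforce
qed

section \<open>Summation over all vertices\<close>

lemma sum_card_in_eq_out:
  "(\<Sum>y\<in>V. real (card {x \<in> V. y \<in> out_nbhd E x i})) = (\<Sum>x\<in>V. real (card (out_nbhd E x i)))"
  if "1 \<le> i"
proof -
  have card_filter: "real (card {x \<in> V. P x}) = (\<Sum>x\<in>V. if P x then 1 else 0)" for P
    using finite_V by (simp add: sum.If_cases Int_def)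
  have "y \<in> V" if "(x, y) \<in> E ^^ i" for x y
    using that \<open>1 \<le> i\<close> edges by (cases i) auto
  then have "out_nbhd E x i = {y \<in> V. y \<in> out_nbhd E x i}" for x
    by (auto simp: out_nbhd_def walk_iff_relpow)
  then have "(\<Sum>x\<in>V. real (card (out_nbhd E x i))) = (\<Sum>x\<in>V. real (card {y \<in> V. y \<in> out_nbhd E x i}))"
    by (metis (no_types, lifting))
  also have "\<dots> = (\<Sum>y\<in>V. real (card {x \<in> V. y \<in> out_nbhd E x i}))"
    unfolding card_filter by (rule sum.swap)
  finally show ?thesis by simp
qed

lemma pow_sum_gt_1:
  assumes free: "\<And>k w. \<lbrakk>1 \<le> k; k \<le> m\<rbrakk> \<Longrightarrow> (w, w) \<notin> E ^^ k"
    and "2 \<le> m" "lam < 1" "V \<noteq> {}"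
  shows "1 < lam ^ m + lam ^ (m - 1)"
proof -
  define S where "S i = (\<Sum>v\<in>V. real (card (out_nbhd E v i)))" for i
  have "(1 - lam) * (\<Sum>i=1..m. S i) =
      (\<Sum>i=1..m. \<Sum>y\<in>V. (1 - lam) * real (card {x \<in> V. y \<in> out_nbhd E x i}))"
    unfolding S_def sum_distrib_left[symmetric] by (simp add: sum_card_in_eq_out)
  also have "\<dots> = (\<Sum>y\<in>V. (1 - lam) * (\<Sum>i=1..m. real (card {x \<in> V. y \<in> out_nbhd E x i})))"
    unfolding sum_distrib_left by (rule sum.swap)
  also have "\<dots> \<le> (\<Sum>y\<in>V. real (card {x \<in> V. y \<in> out_nbhd E x m}))"
    by (intro sum_mono in_ball_bound free)
  also have "\<dots> = S m" using \<open>2 \<le> m\<close> by (simp add: S_def sum_card_in_eq_out)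
  finally have total: "(1 - lam) * (\<Sum>i=1..m. S i) \<le> S m" .
  have Suc: "S (Suc j) \<le> lam * S j" if "1 \<le> j" "j < m" for j
    unfolding S_def sum_distrib_left using card_layer_Suc[of m, OF free] that by (intro sum_mono) auto
  have "S 2 < lam * S 1"
    unfolding S_def sum_distrib_left out_nbhd_1 out_nbhd_2
    using few_second finite_V \<open>V \<noteq> {}\<close> by (intro sum_strict_mono) auto
  have nonneg: "0 \<le> S i" for i by (simp add: S_def sum_nonneg)
  \<comment> \<open>Positivity keeps the inequality for \<open>S 2\<close> strict after
    multiplication by \<open>lam ^ (m - 2)\<close> below.\<close>
  have "0 < lam"
    using \<open>S 2 < lam * S 1\<close> nonneg[of 2] lam_nonneg by (cases "lam = 0") auto
  have layer: "S m \<le> lam ^ (m - i) * S i" if "1 \<le> i" "i \<le> m" for i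
    using that(2)
  proof (induction rule: inc_induct)
    case (step n)
    have "S m \<le> lam ^ (m - Suc n) * S (Suc n)" by (rule step.IH)
    also have "\<dots> \<le> lam ^ (m - Suc n) * (lam * S n)"
      using Suc[of n] step.hyps that lam_nonneg by (intro mult_left_mono) auto
    also have "\<dots> = lam ^ (m - n) * S n"
    proof -
      have "m - n = Suc (m - Suc n)" using step.hyps by simp
      then show ?thesis by simp
    qed
    finally show ?case .
  qed simp
  have first: "S m < lam ^ (m - 1) * S 1"
  proof -
    have "S m \<le> lam ^ (m - 2) * S 2" using layer[of 2] \<open>2 \<le> m\<close> by simp
    also have "\<dots> < lam ^ (m - 2) * (lam * S 1)" using \<open>S 2 < lam * S 1\<close> \<open>0 < lam\<close> by simp
    also have "\<dots> = lam ^ (m - 1) * S 1"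
    proof -
      have "m - 1 = Suc (m - 2)" using \<open>2 \<le> m\<close> by simp
      then show ?thesis by simp
    qed
    finally show ?thesis .
  qed
  \<comment> \<open>Scaling the \<open>i\<close>-th layer bound by \<open>lam ^ (i - 1)\<close>
    gives every right-hand side the factor \<open>lam ^ (m - 1)\<close> and makes the left a
    geometric sum; strictness comes from \<open>i = 1\<close>.\<close>
  have "(\<Sum>i=1..m. lam ^ (i - 1) * S m) < (\<Sum>i=1..m. lam ^ (m - 1) * S i)"
  proof (rule sum_strict_mono_ex1)
    show "\<forall>i\<in>{1..m}. lam ^ (i - 1) * S m \<le> lam ^ (m - 1) * S i"
    proof
      fix i assume i: "i \<in> {1..m}"
      then have "lam ^ (i - 1) * S m \<le> lam ^ (i - 1) * (lam ^ (m - i) * S i)"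
        using layer lam_nonneg by (intro mult_left_mono) auto
      also have "\<dots> = lam ^ (m - 1) * S i"
        using i by (simp flip: power_add mult.assoc)
      finally show "lam ^ (i - 1) * S m \<le> lam ^ (m - 1) * S i" .
    qed
    show "\<exists>i\<in>{1..m}. lam ^ (i - 1) * S m < lam ^ (m - 1) * S i"
      using first \<open>2 \<le> m\<close> by (intro bexI[of _ 1]) auto
  qed simp
  moreover have "(1 - lam) * (\<Sum>i=1..m. lam ^ (i - 1)) = 1 - lam ^ m"
  proof -
    have "(\<Sum>i=1..m. lam ^ (i - 1)) = (\<Sum>i<m. lam ^ i)"
      by (rule sum.reindex_bij_witness[of _ Suc "\<lambda>i. i - 1"]) auto
    then show ?thesis by (simp add: one_diff_power_eq)
  qed
  moreover have "(1 - lam) * (\<Sum>i=1..m. lam ^ (i - 1) * S m) < (1 - lam) * (\<Sum>i=1..m. lam ^ (m - 1) * S i)"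
    using calculation(1) \<open>lam < 1\<close> by (intro mult_strict_left_mono) auto
  ultimately have "(1 - lam ^ m) * S m < lam ^ (m - 1) * ((1 - lam) * (\<Sum>i=1..m. S i))"
    unfolding sum_distrib_left[symmetric] sum_distrib_right[symmetric]
    by (metis mult.assoc mult.left_commute)
  also have "\<dots> \<le> lam ^ (m - 1) * S m" using total lam_nonneg by (intro mult_left_mono) auto
  finally have "0 < (lam ^ m + lam ^ (m - 1) - 1) * S m" by (simp add: algebra_simps)
  \<comment> \<open>Since \<open>S m\<close> is nonnegative, a positive product forces the other
    factor to be positive.\<close>
  then show ?thesis using nonneg[of m] by (simp add: zero_less_mult_iff)
qed

end

section \<open>Reduction to a minimal counterexample\<close>

theorem theorem1:
  fixes m :: nat and lam :: real and V :: "'a set" and E :: "('a \<times> 'a) set"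
  assumes "m \<ge> 2"
    and "0 \<le> lam" and "lam \<le> 1"
    and "lam ^ m + lam ^ (m - 1) \<le> 1"
    and "oriented_graph V E" and "V \<noteq> {}" and "m_free E m"
  shows "\<exists>v\<in>V. real (out_deg E v 2) \<ge> lam * real (out_deg E v 1)"
proof (rule ccontr)
  assume no: "\<not> ?thesis"
  define Q where "Q = (\<lambda>(V' :: 'a set, E'). V' \<subseteq> V \<and> E' \<subseteq> E \<and> E' \<subseteq> V' \<times> V' \<and> V' \<noteq> {} \<and>
    (\<forall>v\<in>V'. real (card (E' `` (E' `` {v}) - E' `` {v})) < lam * real (card (E' `` {v}))))"
  have VE: "finite V" "E \<subseteq> V \<times> V" using \<open>oriented_graph V E\<close> by (auto simp: oriented_graph_def)
  have "finite E" using VE by (meson finite_SigmaI finite_subset)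
  have "Q (V, E)" using no VE \<open>V \<noteq> {}\<close> by (auto simp: Q_def out_deg_def out_nbhd_2 out_nbhd_1[unfolded One_nat_def] not_le)
  \<comment> \<open>Minimising vertices plus edges makes every proper sub-digraph good somewhere,
    whether it arises by deleting edges only or by restricting the vertex set.\<close>
  then obtain V0 E0 where Q0: "Q (V0, E0)"
    and least: "\<And>V' E'. Q (V', E') \<Longrightarrow> card V0 + card E0 \<le> card V' + card E'"
    using ex_has_least_nat[of Q "(V, E)" "\<lambda>(A, B). card A + card B"] by (metis (mono_tags, lifting) case_prod_conv surj_pair)
  have fin0: "finite V0" "finite E0"
    using Q0 finite_subset[of V0 V] finite_subset[of E0 E] VE \<open>finite E\<close> by (auto simp: Q_def)
  interpret minimal_counterexample V0 E0 lam
  proof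
    fix V' E'
    assume sub: "V' \<subseteq> V0" "E' \<subseteq> E0" "E' \<subseteq> V' \<times> V'" "V' \<noteq> {}" "V' \<noteq> V0 \<or> E' \<noteq> E0"
    have "card V' \<le> card V0" "card E' \<le> card E0" using sub fin0 by (auto intro: card_mono)
    moreover have "card V' < card V0 \<or> card E' < card E0"
      using sub fin0 by (metis psubset_card_mono psubsetI)
    ultimately have "\<not> Q (V', E')" using least[of V' E'] by linarith
    then show "\<exists>v\<in>V'. lam * real (card (E' `` {v})) \<le> real (card (E' `` (E' `` {v}) - E' `` {v}))"
      using sub Q0 by (force simp: Q_def not_less)
  qed (use Q0 fin0 \<open>0 \<le> lam\<close> in \<open>auto simp: Q_def\<close>)
  have "(w, w) \<notin> E0 ^^ k" if "1 \<le> k" "k \<le> m" for k w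
  proof
    assume "(w, w) \<in> E0 ^^ k"
    then have "(w, w) \<in> E ^^ k" using Q0 relpow_mono[of E0 E k] by (auto simp: Q_def)
    then show False using closed_walk_imp_cycle[of w k E] that \<open>m_free E m\<close>
      by (meson le_trans m_free_def)
  qed
  moreover have "lam < 1" using assms(3,4) by (cases "lam = 1") auto
  ultimately show False
    using pow_sum_gt_1[of m] Q0 assms(1,4) by (auto simp: Q_def)
qed

end
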